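(* Let $G=(V,E)$ be a connected graph of bounded degree (i.e. $\sup_{v\in V}\deg(v)<\infty$). Then for every $p\in(0,1)$ the $p$-BRW on $G$ is transient if and only if the simple random walk on $G$ is transient.
   Context: Graphs are simple (no loops, no multiple edges). The simple random walk on $G$ is the Markov chain on $V$ with transition probabilities $P(x,y)=\mathbf 1\{\{x,y\}\in E\}/\deg(x)$. Let $\overrightarrow E=\{(x,y):\{x,y\}\in E\}$ be the set of directed edges. The non-backtracking random walk (NBRW) kernel $B$ on $\overrightarrow E$ is $$B((x,y),(z,w))=\frac{\mathbf 1\{y=z,\ w\ne x\}}{\deg(y)-1}+\mathbf 1\{y=z,\ w=x,\ \deg(y)=1\},$$ where the first term is $0$ if $\deg(y)=1$. For $p\in(0,1)$, the $p$-BRW is the Markov chain on $\overrightarrow E$ with transition kernel $$B_p((x,y),(z,w))=(1-p)B((x,y),(z,w))+p\,\mathbf 1\{z=y,\ w=x\}.$$ Transience and recurrence of the $p$-BRW are in the usual sense of Markov chains on $\overrightarrow E$ (the paper notes that this is equivalent to the notion defined via infinitely many returns to a starting vertex). *)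

theory Defs
  imports "HOL-Probability.Probability"
begin

section \<open>Graphs\<close>

definition simple_graph :: "'a set \<Rightarrow> 'a set set \<Rightarrow> bool" where
  "simple_graph V E \<longleftrightarrow> (\<forall>e\<in>E. \<exists>x\<in>V. \<exists>y\<in>V. x \<noteq> y \<and> e = {x, y})"

definition neighbours :: "'a set set \<Rightarrow> 'a \<Rightarrow> 'a set" where
  "neighbours E x = {y. {x, y} \<in> E}"

definition deg :: "'a set set \<Rightarrow> 'a \<Rightarrow> nat" where
  "deg E x = card (neighbours E x)"

definition directed_edges :: "'a set set \<Rightarrow> ('a \<times> 'a) set" where
  "directed_edges E = {(x, y). {x, y} \<in> E}"

definition connected_graph :: "'a set \<Rightarrow> 'a set set \<Rightarrow> bool" where
  "connected_graph V E \<longleftrightarrow> (\<forall>x\<in>V. \<forall>y\<in>V. (x, y) \<in> (directed_edges E)\<^sup>*)"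

text \<open>Finiteness of the neighbourhoods is required explicitly, as an infinite set has \<open>card\<close> 0.\<close>

definition bounded_degree :: "'a set \<Rightarrow> 'a set set \<Rightarrow> bool" where
  "bounded_degree V E \<longleftrightarrow> (\<exists>D. \<forall>v\<in>V. finite (neighbours E v) \<and> deg E v \<le> D)"


section \<open>Markov chains on a discrete state space\<close>

text \<open>
  A chain is given by a state space \<open>S\<close> and transition probabilities \<open>K x y\<close> for \<open>x, y \<in> S\<close>;
  values of \<open>K\<close> outside \<open>S\<close> are ignored. A state whose row is not a probability vector is
  made absorbing, so that the law of the chain is always defined; for the walks below,
  on a graph of bounded degree, this concerns no state except an isolated vertex under simple
  random walk.
\<close>

definition trans_row :: "'s set \<Rightarrow> ('s \<Rightarrow> 's \<Rightarrow> real) \<Rightarrow> 's \<Rightarrow> 's \<Rightarrow> real" where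
  "trans_row S K x y = (if x \<in> S \<and> y \<in> S then K x y else 0)"

definition stochastic_row :: "'s set \<Rightarrow> ('s \<Rightarrow> 's \<Rightarrow> real) \<Rightarrow> 's \<Rightarrow> bool" where
  "stochastic_row S K x \<longleftrightarrow>
     (\<forall>y. 0 \<le> trans_row S K x y) \<and> (\<integral>\<^sup>+y. ennreal (trans_row S K x y) \<partial>count_space UNIV) = 1"

definition step_pmf :: "'s set \<Rightarrow> ('s \<Rightarrow> 's \<Rightarrow> real) \<Rightarrow> 's \<Rightarrow> 's pmf" where
  "step_pmf S K x = (if stochastic_row S K x then embed_pmf (trans_row S K x) else return_pmf x)"

text \<open>
  The law on trajectories of the chain started at \<open>s\<close>, as the Ionescu-Tulcea limit of the
  conditional laws of the \<open>i\<close>-th coordinate given the previous ones.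
\<close>

definition cond_law :: "'s set \<Rightarrow> ('s \<Rightarrow> 's \<Rightarrow> real) \<Rightarrow> 's \<Rightarrow> nat \<Rightarrow> (nat \<Rightarrow> 's) \<Rightarrow> 's measure" where
  "cond_law S K s i \<omega> =
     measure_pmf (if i = 0 then return_pmf s else step_pmf S K (\<omega> (i - 1)))"

definition chain_law :: "'s set \<Rightarrow> ('s \<Rightarrow> 's \<Rightarrow> real) \<Rightarrow> 's \<Rightarrow> (nat \<Rightarrow> 's) measure" where
  "chain_law S K s =
     projective_family.lim UNIV
       (Ionescu_Tulcea.CI (cond_law S K s) (\<lambda>_. count_space UNIV)) (\<lambda>_. count_space UNIV)"

definition return_prob :: "'s set \<Rightarrow> ('s \<Rightarrow> 's \<Rightarrow> real) \<Rightarrow> 's \<Rightarrow> real" where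
  "return_prob S K s = measure (chain_law S K s) {\<omega>. \<exists>n\<ge>1. \<omega> n = s}"

text \<open>
  For an irreducible chain, all states are transient if and only if one is. The empty state space,
  which below arises only for edgeless graphs, does not count as transient.
\<close>

definition transient_chain :: "'s set \<Rightarrow> ('s \<Rightarrow> 's \<Rightarrow> real) \<Rightarrow> bool" where
  "transient_chain S K \<longleftrightarrow> S \<noteq> {} \<and> (\<forall>s\<in>S. return_prob S K s < 1)"


section \<open>The random walks\<close>

definition srw :: "'a set set \<Rightarrow> 'a \<Rightarrow> 'a \<Rightarrow> real" where
  "srw E x y = of_bool ({x, y} \<in> E) / real (deg E x)"

text \<open>For \<open>deg E y = 1\<close> the first summand is a division by 0, that is 0.\<close>

fun nbrw :: "'a set set \<Rightarrow> 'a \<times> 'a \<Rightarrow> 'a \<times> 'a \<Rightarrow> real" where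
  "nbrw E (x, y) (z, w) =
     of_bool (y = z \<and> w \<noteq> x) / (real (deg E y) - 1) + of_bool (y = z \<and> w = x \<and> deg E y = 1)"

fun brw :: "'a set set \<Rightarrow> real \<Rightarrow> 'a \<times> 'a \<Rightarrow> 'a \<times> 'a \<Rightarrow> real" where
  "brw E p (x, y) (z, w) =
     (1 - p) * nbrw E (x, y) (z, w) + p * of_bool (z = y \<and> w = x)"

definition srw_transient :: "'a set \<Rightarrow> 'a set set \<Rightarrow> bool" where
  "srw_transient V E \<longleftrightarrow> transient_chain V (srw E)"

definition brw_transient :: "'a set set \<Rightarrow> real \<Rightarrow> bool" where
  "brw_transient E p \<longleftrightarrow> transient_chain (directed_edges E) (brw E p)"


section \<open>Well-definedness\<close>

lemma Ionescu_Tulcea_cond_law: "Ionescu_Tulcea (cond_law S K s) (\<lambda>_. count_space UNIV)"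
proof (rule Ionescu_Tulcea.intro)
  fix i
  show "cond_law S K s i \<in> measurable (PiM {0..<i} (\<lambda>_. count_space UNIV))
          (subprob_algebra (count_space UNIV))"
  proof (cases i)
    case 0
    then show ?thesis
      by (simp add: cond_law_def[abs_def] measure_pmf_in_subprob_algebra)
  next
    case (Suc j)
    have c: "(\<lambda>\<omega>. \<omega> j) \<in> measurable (PiM {0..<i} (\<lambda>_. count_space UNIV)) (count_space UNIV)"
      by (rule measurable_component_singleton) (simp add: Suc)
    have "(\<lambda>x. measure_pmf (step_pmf S K x)) \<in>
            measurable (count_space UNIV) (subprob_algebra (count_space UNIV))"
      by (simp add: measure_pmf_in_subprob_algebra)
    from measurable_compose[OF c this] show ?thesis
      by (simp add: cond_law_def[abs_def] Suc)
  qed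
next
  fix i \<omega>
  show "prob_space (cond_law S K s i \<omega>)"
    unfolding cond_law_def by (rule prob_space_measure_pmf)
qed

lemma sets_chain_law: "sets (chain_law S K s) = sets (PiM UNIV (\<lambda>_. count_space UNIV))"
proof -
  interpret IT: Ionescu_Tulcea "cond_law S K s" "\<lambda>_. count_space UNIV"
    by (rule Ionescu_Tulcea_cond_law)
  show ?thesis unfolding chain_law_def by simp
qed

lemma space_chain_law: "space (chain_law S K s) = UNIV"
  using sets_eq_imp_space_eq[OF sets_chain_law] by (simp add: space_PiM)

lemma prob_space_chain_law: "prob_space (chain_law S K s)"
proof -
  interpret IT: Ionescu_Tulcea "cond_law S K s" "\<lambda>_. count_space UNIV"
    by (rule Ionescu_Tulcea_cond_law)
  have "emeasure IT.PF.lim (IT.PF.emb UNIV {} (space (PiM {} (\<lambda>_. count_space UNIV)))) =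
          emeasure (IT.CI {}) (space (PiM {} (\<lambda>_. count_space UNIV)))"
    by (rule IT.lim) simp_all
  also have "\<dots> = 1"
    using prob_space.emeasure_space_1[OF IT.PF.prob_space_P[of "{}"]]
    by (simp add: IT.CI_def)
  finally have "emeasure (chain_law S K s) UNIV = 1"
    by (simp add: chain_law_def prod_emb_def space_PiM vimage_def restrict_def)
  then show ?thesis
    by (intro prob_spaceI) (simp add: space_chain_law)
qed

theorem emeasure_chain_law_cylinder:
  "emeasure (chain_law S K s) {\<omega>. \<forall>i\<le>n. \<omega> i = x i} =
     ennreal (of_bool (x 0 = s) * (\<Prod>i<n. pmf (step_pmf S K (x i)) (x (Suc i))))"
proof -
  let ?M = "\<lambda>_::nat. count_space (UNIV::'a set)"
  interpret IT: Ionescu_Tulcea "cond_law S K s" ?M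
    by (rule Ionescu_Tulcea_cond_law)
  let ?X = "\<lambda>n. PiE {0..<n} (\<lambda>i. {x i})"
  have X: "?X n \<in> sets (PiM {0..<n} ?M)" for n
    by (rule sets_PiM_I_finite) auto
  have X_eq: "?X n = {restrict x {0..<n}}" for n
    by (auto simp: PiE_def extensional_def fun_eq_iff Pi_iff)
  have C: "emeasure (IT.C 0 (Suc n) (\<lambda>_. undefined)) (?X (Suc n)) =
     ennreal (of_bool (x 0 = s) * (\<Prod>i<n. pmf (step_pmf S K (x i)) (x (Suc i))))" for n
  proof (induction n)
    case 0
    have u: "(\<lambda>_. undefined) \<in> space (PiM {0..<0} ?M)" by (simp add: space_PiM)
    have "emeasure (IT.C 0 (Suc 0) (\<lambda>_. undefined)) (?X (Suc 0)) =
            emeasure (IT.eP 0 (\<lambda>_. undefined)) (?X (Suc 0))"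
      using bind_return[OF IT.measurable_eP u] by simp
    also have "\<dots> = cond_law S K s 0 (\<lambda>_. undefined)
                    ((\<lambda>y. (\<lambda>_. undefined)(0 := y)) -` ?X (Suc 0) \<inter> space (?M 0))"
      by (rule IT.emeasure_eP[OF u X])
    also have "(\<lambda>y. (\<lambda>_. undefined)(0 := y)) -` ?X (Suc 0) \<inter> space (?M 0) = {x 0}"
    proof -
      have iff: "(\<lambda>_. undefined)(0 := y) = restrict x {0..<Suc 0} \<longleftrightarrow> y = x 0" for y
      proof
        assume "(\<lambda>_. undefined)(0 := y) = restrict x {0..<Suc 0}"
        from fun_cong[OF this, of 0] show "y = x 0" by simp
      next
        assume "y = x 0"
        then show "(\<lambda>_. undefined)(0 := y) = restrict x {0..<Suc 0}"
          by (intro ext) simp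
      qed
      show ?thesis
        unfolding X_eq
        by (simp only: vimage_def singleton_iff space_count_space Int_UNIV_right iff singleton_conv)
    qed
    also have "emeasure (cond_law S K s 0 (\<lambda>_. undefined)) {x 0} = ennreal (of_bool (x 0 = s))"
      by (simp add: cond_law_def emeasure_pmf_single)
    finally show ?case by simp
  next
    case (Suc n)
    let ?N = "IT.C 0 (Suc n) (\<lambda>_. undefined)"
    have u: "(\<lambda>_. undefined) \<in> space (PiM {0..<0} ?M)" by (simp add: space_PiM)
    have spN: "space ?N = space (PiM {0..<Suc n} ?M)"
      and setsN: "sets ?N = sets (PiM {0..<Suc n} ?M)"
      using IT.space_C[OF u, of "Suc n"] IT.sets_C[OF u, of "Suc n"] by simp_all
    have "emeasure (IT.C 0 (Suc (Suc n)) (\<lambda>_. undefined)) (?X (Suc (Suc n))) =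
        (\<integral>\<^sup>+\<omega>. emeasure (IT.eP (Suc n) \<omega>) (?X (Suc (Suc n))) \<partial>?N)"
    proof -
      have ne: "space ?N \<noteq> {}" by (rule prob_space.not_empty[OF IT.prob_space_C[OF u]])
      have m: "IT.eP (Suc n) \<in> measurable ?N (subprob_algebra (PiM {0..<Suc (Suc n)} ?M))"
        using IT.measurable_eP[of "Suc n"] by (simp only: measurable_cong_sets[OF setsN refl])
      show ?thesis
        using emeasure_bind[OF ne m X[of "Suc (Suc n)"]]
        by (subst IT.C.simps(2)) (simp only: add_0)
    qed
    also have "\<dots> = (\<integral>\<^sup>+\<omega>. ennreal (pmf (step_pmf S K (x n)) (x (Suc n))) *
                        indicator (?X (Suc n)) \<omega> \<partial>?N)"
    proof (rule nn_integral_cong)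
      fix \<omega> assume "\<omega> \<in> space ?N"
      then have \<omega>: "\<omega> \<in> space (PiM {0..<Suc n} ?M)" by (simp only: spN)
      have "(\<lambda>y. fun_upd \<omega> (Suc n) y) -` ?X (Suc (Suc n)) \<inter> space (?M (Suc n)) =
              (if \<omega> \<in> ?X (Suc n) then {x (Suc n)} else {})"
      proof -
        have ext: "\<omega> i = undefined" if "i \<ge> Suc n" for i
          using \<omega> that by (simp add: space_PiM PiE_iff extensional_def)
        have iff: "fun_upd \<omega> (Suc n) y = restrict x {0..<Suc (Suc n)} \<longleftrightarrow>
                \<omega> = restrict x {0..<Suc n} \<and> y = x (Suc n)" (is "?l \<longleftrightarrow> ?r") for y
        proof
          assume l: ?l
          have "\<omega> i = restrict x {0..<Suc n} i" for i
            using fun_cong[OF l, of i] ext[of i] by (cases "i < Suc n") simp_all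
          moreover have "y = x (Suc n)"
            using fun_cong[OF l, of "Suc n"] by simp
          ultimately show ?r by blast
        next
          assume r: ?r
          show ?l
          proof
            fix i show "fun_upd \<omega> (Suc n) y i = restrict x {0..<Suc (Suc n)} i"
              using r by (cases "i = Suc n") (simp_all add: less_Suc_eq)
          qed
        qed
        show ?thesis
          unfolding X_eq
          by (simp only: vimage_def singleton_iff space_count_space Int_UNIV_right iff) auto
      qed
      then have "emeasure (IT.eP (Suc n) \<omega>) (?X (Suc (Suc n))) =
              cond_law S K s (Suc n) \<omega> (if \<omega> \<in> ?X (Suc n) then {x (Suc n)} else {})"
        using IT.emeasure_eP[OF \<omega> X] by simp
      also have "\<dots> = ennreal (pmf (step_pmf S K (x n)) (x (Suc n))) * indicator (?X (Suc n)) \<omega>"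
        by (auto simp: cond_law_def emeasure_pmf_single X_eq)
      finally show "emeasure (IT.eP (Suc n) \<omega>) (?X (Suc (Suc n))) =
         ennreal (pmf (step_pmf S K (x n)) (x (Suc n))) * indicator (?X (Suc n)) \<omega>" .
    qed
    also have "\<dots> = ennreal (pmf (step_pmf S K (x n)) (x (Suc n))) * emeasure ?N (?X (Suc n))"
      using X[of "Suc n"] by (subst nn_integral_cmult_indicator) (simp_all add: setsN del: IT.C.simps)
    also have "\<dots> = ennreal (of_bool (x 0 = s) *
        (\<Prod>i<Suc n. pmf (step_pmf S K (x i)) (x (Suc i))))"
      by (simp only: Suc) (simp add: ennreal_mult'[symmetric] mult_ac prod_nonneg)
    finally show ?case .
  qed
  have "{\<omega>. \<forall>i\<le>n. \<omega> i = x i} = IT.PF.emb UNIV {0..<Suc n} (?X (Suc n))"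
    by (auto simp: prod_emb_def space_PiM PiE_iff less_Suc_eq_le)
  then have "emeasure (chain_law S K s) {\<omega>. \<forall>i\<le>n. \<omega> i = x i} = emeasure (IT.CI {0..<Suc n}) (?X (Suc n))"
    unfolding chain_law_def using IT.lim[OF _ X[of "Suc n"]] by simp
  also have "\<dots> = emeasure (IT.C 0 (Suc n) (\<lambda>_. undefined)) (?X (Suc n))"
  proof -
    have "IT.PF.emb {0..<Suc n} {0..<Suc n} (?X (Suc n)) = ?X (Suc n)"
      by (rule prod_emb_id) (auto simp: PiE_iff)
    then show ?thesis
      using IT.emeasure_CI[OF order_refl X[of "Suc n"]] by (simp only:)
  qed
  finally show ?thesis using C by simp
qed

lemma return_event_in_sets: "{\<omega>. \<exists>n\<ge>1. \<omega> n = s} \<in> sets (chain_law S K s)"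
proof -
  have "{\<omega> \<in> space (PiM UNIV (\<lambda>_. count_space UNIV)). \<exists>n\<ge>(1::nat). \<omega> n = s}
          \<in> sets (PiM UNIV (\<lambda>_::nat. count_space UNIV))"
    by measurable
  then show ?thesis
    by (simp add: sets_chain_law space_PiM)
qed

lemma pmf_step_pmf: "stochastic_row S K x \<Longrightarrow> pmf (step_pmf S K x) y = trans_row S K x y"
  by (simp add: step_pmf_def stochastic_row_def pmf_embed_pmf)

lemma stochastic_rowI:
  assumes "finite F" "F \<subseteq> S" "x \<in> S" "\<And>y. y \<in> S \<Longrightarrow> 0 \<le> K x y"
    "\<And>y. y \<in> S \<Longrightarrow> y \<notin> F \<Longrightarrow> K x y = 0" "(\<Sum>y\<in>F. K x y) = 1"
  shows "stochastic_row S K x"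
proof -
  have "(\<integral>\<^sup>+y. ennreal (trans_row S K x y) \<partial>count_space UNIV) = (\<Sum>y\<in>F. ennreal (trans_row S K x y))"
    using assms by (intro nn_integral_count_space') (auto simp: trans_row_def)
  also have "\<dots> = ennreal (\<Sum>y\<in>F. K x y)"
  proof -
    have "(\<Sum>y\<in>F. ennreal (trans_row S K x y)) = (\<Sum>y\<in>F. ennreal (K x y))"
      using assms(2,3) by (intro sum.cong) (auto simp: trans_row_def)
    also have "\<dots> = ennreal (\<Sum>y\<in>F. K x y)"
      using assms(2,4) by (intro sum_ennreal) auto
    finally show ?thesis .
  qed
  finally show ?thesis
    using assms by (auto simp: stochastic_row_def trans_row_def)
qed

lemma stochastic_row_srw:
  assumes "simple_graph V E" "bounded_degree V E" "x \<in> V" "neighbours E x \<noteq> {}"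
  shows "stochastic_row V (srw E) x"
proof (rule stochastic_rowI)
  show fin: "finite (neighbours E x)"
    using assms by (auto simp: bounded_degree_def)
  show "neighbours E x \<subseteq> V"
    using assms(1) by (force simp: simple_graph_def neighbours_def doubleton_eq_iff)
  show "(\<Sum>y\<in>neighbours E x. srw E x y) = 1"
    using fin assms(4) by (simp add: srw_def deg_def neighbours_def)
qed (use assms in \<open>auto simp: srw_def neighbours_def\<close>)

lemma stochastic_row_brw:
  assumes "simple_graph V E" "bounded_degree V E" "0 < p" "p < 1" "e \<in> directed_edges E"
  shows "stochastic_row (directed_edges E) (brw E p) e"
proof -
  obtain x y where e: "e = (x, y)" by (cases e)
  let ?N = "neighbours E y"
  have "y \<in> V"
    using assms(1,5) by (force simp: e directed_edges_def simple_graph_def doubleton_eq_iff)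
  then have fin: "finite ?N"
    using assms(2) by (auto simp: bounded_degree_def)
  have x: "x \<in> ?N"
    using assms(5) by (auto simp: e directed_edges_def neighbours_def insert_commute)
  have d1: "1 \<le> deg E y"
    using fin x by (auto simp: deg_def Suc_le_eq card_gt_0_iff)
  have "(\<Sum>w\<in>?N. nbrw E (x, y) (y, w)) =
      (\<Sum>w\<in>?N - {x}. 1 / (real (deg E y) - 1)) + of_bool (deg E y = 1)"
    by (subst sum.remove[OF fin x]) (auto intro!: sum.cong)
  also have "\<dots> = 1"
    using d1 fin x by (cases "deg E y = 1") (auto simp: deg_def[symmetric] of_nat_diff)
  finally have nb: "(\<Sum>w\<in>?N. nbrw E (x, y) (y, w)) = 1" .
  have bt: "(\<Sum>w\<in>?N. of_bool (w = x)) = (1::real)"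
    by (subst sum.remove[OF fin x]) auto
  show ?thesis unfolding e
  proof (rule stochastic_rowI)
    show "finite (Pair y ` ?N)" using fin by simp
    show "Pair y ` ?N \<subseteq> directed_edges E" by (auto simp: neighbours_def directed_edges_def)
    show "(x, y) \<in> directed_edges E" using assms(5) e by simp
    show "0 \<le> brw E p (x, y) f" for f
      using assms(3,4) d1 by (cases f) auto
    show "brw E p (x, y) f = 0" if "f \<in> directed_edges E" "f \<notin> Pair y ` ?N" for f
      using that by (cases f) (auto simp: neighbours_def directed_edges_def)
    have "(\<Sum>f\<in>Pair y ` ?N. brw E p (x, y) f) = (\<Sum>w\<in>?N. brw E p (x, y) (y, w))"
      by (subst sum.reindex) (auto simp: inj_on_def)
    also have "\<dots> = (1 - p) * (\<Sum>w\<in>?N. nbrw E (x, y) (y, w)) + p * (\<Sum>w\<in>?N. of_bool (w = x))"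
      by (simp add: sum.distrib sum_distrib_left del: nbrw.simps)
    finally show "(\<Sum>f\<in>Pair y ` ?N. brw E p (x, y) f) = 1"
      using nb bt by simp
  qed
qed

end

theory Submission
  imports Defs
begin

text \<open>
  A state has return probability less than 1 iff some bounded superharmonic function is strictly
  superharmonic there. Eliminating the values on directed edges in favour of their averages over
  the edges leaving a vertex turns superharmonic functions of the \<open>p\<close>-BRW into
  superharmonic functions of a reversible network on \<open>V\<close>, whose conductances are bounded above and
  below by positive constants. So it remains to compare two networks with comparable conductances.
  If \<open>A > 0\<close> is superharmonic and strictly so at \<open>b\<close>, the ground state transform gives
  \<open>k * (u b)\<^sup>2 \<le> energy u\<close> for finitely supported \<open>u\<close>, an inequality that passes to the other
  network up to a constant. Applied there to the truncated Green function
  \<open>u = (\<Sum>k\<le>n. P\<^sup>k \<delta>\<^sub>b)\<close>, whose energy is at most a constant times \<open>u b\<close>, it bounds \<open>u b\<close>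
  uniformly in \<open>n\<close>, and the limit of the functions \<open>u\<close> truncated at height \<open>G(b, b)\<close> is the
  required superharmonic function.
\<close>

section \<open>Return probabilities and superharmonic functions\<close>

primrec path_pmf :: "('s \<Rightarrow> 's pmf) \<Rightarrow> nat \<Rightarrow> 's \<Rightarrow> 's list pmf" where
  "path_pmf P 0 x = return_pmf [x]"
| "path_pmf P (Suc n) x = P x \<bind> (\<lambda>y. map_pmf ((#) x) (path_pmf P n y))"

lemma pmf_map_pmf_Cons:
  "pmf (map_pmf ((#) x) q) l = (case l of [] \<Rightarrow> 0 | z # l' \<Rightarrow> of_bool (z = x) * pmf q l')"
proof (cases l)
  case Nil
  have "(#) x -` {[]} = {}" by auto
  then show ?thesis by (simp add: pmf_map Nil)
next
  case (Cons z l')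
  have "(#) x -` {z # l'} = (if z = x then {l'} else {})" by auto
  then show ?thesis by (simp add: pmf_map Cons measure_pmf_single)
qed

lemma pmf_path_pmf:
  "pmf (path_pmf P n x) l =
     of_bool (length l = Suc n \<and> l ! 0 = x) * (\<Prod>i<n. pmf (P (l ! i)) (l ! Suc i))"
proof (induction n arbitrary: x l)
  case 0
  show ?case by (cases l) (auto simp: indicator_def)
next
  case (Suc n)
  show ?case
  proof (cases l)
    case Nil
    then show ?thesis by (simp add: pmf_bind pmf_map_pmf_Cons)
  next
    case (Cons z l')
    let ?c = "of_bool (z = x \<and> length l' = Suc n) * (\<Prod>i<n. pmf (P (l' ! i)) (l' ! Suc i))"
    have "pmf (path_pmf P (Suc n) x) l = (\<integral>y. of_bool (z = x) * pmf (path_pmf P n y) l' \<partial>P x)"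
      by (simp add: pmf_bind pmf_map_pmf_Cons Cons)
    also have "\<dots> = (\<integral>y. ?c * indicator {l' ! 0} y \<partial>P x)"
      by (intro Bochner_Integration.integral_cong) (auto simp: Suc.IH)
    also have "\<dots> = ?c * pmf (P x) (l' ! 0)"
      by (simp add: measure_pmf_single)
    finally show ?thesis
      by (auto simp: Cons prod.lessThan_Suc_shift simp del: prod.lessThan_Suc path_pmf.simps)
  qed
qed

lemma set_path_pmf: "l \<in> set_pmf (path_pmf P n x) \<Longrightarrow> length l = Suc n \<and> l ! 0 = x"
  by (auto simp: set_pmf_iff pmf_path_pmf)

text \<open>A path law has countable support, so its mass on an event is a sum over disjoint
  cylinders. Only an inequality results: on an uncountable state space these cylinders need not
  cover the event.\<close>

lemma emeasure_path_pmf_le_chain_law: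
  assumes "{\<omega>. Q (map \<omega> [0..<Suc n])} \<in> sets (chain_law S K s)"
  shows "emeasure (path_pmf (step_pmf S K) n s) {l. Q l}
           \<le> emeasure (chain_law S K s) {\<omega>. Q (map \<omega> [0..<Suc n])}"
proof -
  let ?p = "path_pmf (step_pmf S K) n s" and ?M = "chain_law S K s"
  let ?A = "{l. Q l} \<inter> set_pmf ?p"
  let ?C = "\<lambda>l. {\<omega>. \<forall>i\<le>n. \<omega> i = l ! i}"
  have C_sets: "?C l \<in> sets ?M" for l
  proof -
    have "{\<omega> \<in> space (PiM UNIV (\<lambda>_. count_space UNIV)). \<forall>i\<le>n. \<omega> i = l ! i}
            \<in> sets (PiM UNIV (\<lambda>_::nat. count_space UNIV))"
      by measurable
    then show ?thesis
      by (simp add: sets_chain_law space_PiM)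
  qed
  have map_eq: "map \<omega> [0..<Suc n] = l \<longleftrightarrow> \<omega> \<in> ?C l" if "l \<in> ?A" for \<omega> l
    using set_path_pmf[of l] that
    by (auto simp: list_eq_iff_nth_eq less_Suc_eq_le simp del: upt_Suc)
  have "emeasure ?p {l. Q l} = emeasure ?p ?A"
    by (simp add: emeasure_Int_set_pmf)
  also have "\<dots> = (\<integral>\<^sup>+l. ennreal (pmf ?p l) \<partial>count_space ?A)"
    by (rule nn_integral_pmf[symmetric])
  also have "\<dots> = (\<integral>\<^sup>+l. emeasure ?M (?C l) \<partial>count_space ?A)"
    using set_path_pmf[of _ "step_pmf S K" n s]
    by (intro nn_integral_cong)
       (auto simp: emeasure_chain_law_cylinder pmf_path_pmf)
  also have "\<dots> = emeasure ?M (\<Union>l\<in>?A. ?C l)"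
  proof (rule emeasure_UN_countable[symmetric])
    show "countable ?A" by (intro countable_Int2) simp
    show "disjoint_family_on ?C ?A"
      unfolding disjoint_family_on_def
    proof (intro ballI impI equals0I)
      fix l l' \<omega> assume "l \<in> ?A" "l' \<in> ?A" "l \<noteq> l'" "\<omega> \<in> ?C l \<inter> ?C l'"
      then have "map \<omega> [0..<Suc n] = l" "map \<omega> [0..<Suc n] = l'"
        by (simp_all only: map_eq Int_iff)
      with \<open>l \<noteq> l'\<close> show False by simp
    qed
  qed (rule C_sets)
  also have "\<dots> \<le> emeasure ?M {\<omega>. Q (map \<omega> [0..<Suc n])}"
  proof (intro emeasure_mono assms subsetI CollectI)
    fix \<omega> assume "\<omega> \<in> (\<Union>l\<in>?A. ?C l)"
    then obtain l where l: "l \<in> ?A" "\<omega> \<in> ?C l" by (rule UN_E)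
    then have "map \<omega> [0..<Suc n] = l" by (simp only: map_eq)
    then show "Q (map \<omega> [0..<Suc n])" using l(1) by (simp del: upt_Suc)
  qed
  finally show ?thesis .
qed

text \<open>The one-sided bound applies to the event and to its complement; as both pairs of
  probabilities sum to 1, it is an equality.\<close>

lemma measure_chain_law_path:
  assumes "{\<omega>. Q (map \<omega> [0..<Suc n])} \<in> sets (chain_law S K s)"
  shows "measure (chain_law S K s) {\<omega>. Q (map \<omega> [0..<Suc n])}
           = measure_pmf.prob (path_pmf (step_pmf S K) n s) {l. Q l}"
proof -
  let ?p = "path_pmf (step_pmf S K) n s"
  interpret M: prob_space "chain_law S K s" by (rule prob_space_chain_law)
  let ?H = "{\<omega>. Q (map \<omega> [0..<Suc n])}"
  have co: "{\<omega>. \<not> Q (map \<omega> [0..<Suc n])} = space (chain_law S K s) - ?H"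
    by (auto simp: space_chain_law)
  have "measure_pmf.prob ?p {l. Q l} \<le> M.prob ?H"
    using emeasure_path_pmf_le_chain_law[OF assms]
    by (simp add: M.emeasure_eq_measure measure_pmf.emeasure_eq_measure del: upt_Suc)
  moreover have "measure_pmf.prob ?p {l. \<not> Q l} \<le> M.prob {\<omega>. \<not> Q (map \<omega> [0..<Suc n])}"
  proof -
    have "{\<omega>. \<not> Q (map \<omega> [0..<Suc n])} \<in> sets (chain_law S K s)"
      unfolding co by (rule sets.compl_sets[OF assms])
    from emeasure_path_pmf_le_chain_law[OF this] show ?thesis
      by (simp add: M.emeasure_eq_measure measure_pmf.emeasure_eq_measure del: upt_Suc)
  qed
  moreover have "M.prob {\<omega>. \<not> Q (map \<omega> [0..<Suc n])} = 1 - M.prob ?H"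
    unfolding co by (rule M.prob_compl[OF assms])
  moreover have "measure_pmf.prob ?p {l. \<not> Q l} = 1 - measure_pmf.prob ?p {l. Q l}"
    using measure_pmf.prob_compl[of "{l. Q l}" ?p] by (simp add: Collect_neg_eq Compl_eq_Diff_UNIV)
  ultimately show ?thesis by linarith
qed

section \<open>Returns within finitely many steps\<close>

definition return_within :: "('s \<Rightarrow> 's pmf) \<Rightarrow> 's \<Rightarrow> nat \<Rightarrow> 's \<Rightarrow> real" where
  "return_within P s n x = measure_pmf.prob (path_pmf P n x) {l. s \<in> set (tl l)}"

lemma return_within_bounds: "0 \<le> return_within P s n x" "return_within P s n x \<le> 1"
  by (simp_all add: return_within_def)

lemma return_within_0: "return_within P s 0 x = 0"
  by (simp add: return_within_def)

text \<open>First-step analysis. Time 0 is dropped by \<open>tl\<close>, while a visit at time 1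
  already counts, whence the value 1 for \<open>y = s\<close>.\<close>

lemma return_within_Suc:
  "return_within P s (Suc n) x = (\<integral>y. (if y = s then 1 else return_within P s n y) \<partial>P x)"
proof -
  have hit: "measure_pmf.prob (path_pmf P n y) {l. s \<in> set l}
          = (if y = s then 1 else return_within P s n y)" for y
  proof -
    have hd_tl: "s \<in> set l \<longleftrightarrow> s = y \<or> s \<in> set (tl l)"
      if "l \<in> set_pmf (path_pmf P n y)" for l
      using set_path_pmf[OF that] by (cases l) auto
    show ?thesis
    proof (cases "y = s")
      case True
      have "set_pmf (path_pmf P n y) \<subseteq> {l. s \<in> set l}"
        using hd_tl True by blast
      then have "measure_pmf.prob (path_pmf P n y) {l. s \<in> set l} = 1"
        by (subst measure_pmf.prob_eq_1) (auto simp: AE_measure_pmf_iff)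
      then show ?thesis using True by simp
    next
      case False
      then have "{l. s \<in> set l} \<inter> set_pmf (path_pmf P n y)
                   = {l. s \<in> set (tl l)} \<inter> set_pmf (path_pmf P n y)"
        using hd_tl by blast
      then show ?thesis
        using False by (metis measure_Int_set_pmf return_within_def)
    qed
  qed
  have "return_within P s (Suc n) x
      = measure (measure_pmf (P x \<bind> path_pmf P n)) {l. s \<in> set l}"
  proof -
    have "return_within P s (Suc n) x
        = measure_pmf.prob (map_pmf ((#) x) (P x \<bind> path_pmf P n)) {l. s \<in> set (tl l)}"
      by (simp add: return_within_def map_bind_pmf)
    then show ?thesis by (simp add: vimage_def)
  qed
  also have "\<dots> = (\<integral>y. measure_pmf.prob (path_pmf P n y) {l. s \<in> set l} \<partial>P x)"
    by (simp add: measure_pmf_bind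
        measure_pmf.measure_bind[where N = "count_space UNIV"] measure_pmf_in_subprob_algebra)
  finally show ?thesis by (simp add: hit)
qed

lemma return_within_mono: "return_within P s n x \<le> return_within P s (Suc n) x"
proof (induction n arbitrary: x)
  case 0
  show ?case by (simp only: return_within_0 return_within_bounds)
next
  case (Suc n)
  show ?case
    unfolding return_within_Suc[of P s n x] return_within_Suc[of P s "Suc n" x]
    by (intro integral_mono measure_pmf.integrable_const_bound[where B = 1])
       (use Suc in \<open>auto simp: return_within_bounds\<close>)
qed

lemma return_within_tendsto:
  "(\<lambda>n. return_within (step_pmf S K) s n s) \<longlonglongrightarrow> return_prob S K s"
proof -
  let ?M = "chain_law S K s"
  interpret M: prob_space ?M by (rule prob_space_chain_law)
  let ?H = "\<lambda>n::nat. {\<omega>. \<exists>k\<ge>1. k \<le> n \<and> \<omega> k = s}"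
  have H_sets: "?H n \<in> sets ?M" for n
  proof -
    have "{\<omega> \<in> space (PiM UNIV (\<lambda>_. count_space UNIV)). \<exists>k\<ge>1. k \<le> n \<and> \<omega> k = s}
            \<in> sets (PiM UNIV (\<lambda>_::nat. count_space UNIV))"
      by measurable
    then show ?thesis
      by (simp add: sets_chain_law space_PiM)
  qed
  have "(\<lambda>n. M.prob (?H n)) \<longlonglongrightarrow> M.prob (\<Union>n. ?H n)"
    using H_sets by (intro M.finite_Lim_measure_incseq) (auto simp: incseq_def)
  moreover have "(\<Union>n. ?H n) = {\<omega>. \<exists>n\<ge>1. \<omega> n = s}"
    using order_refl by blast
  moreover have "M.prob (?H n) = return_within (step_pmf S K) s n s" for n
  proof -
    have "s \<in> set (tl (map \<omega> [0..<Suc n])) \<longleftrightarrow> \<omega> \<in> ?H n" for \<omega>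
    proof -
      have "tl (map \<omega> [0..<Suc n]) = map \<omega> [1..<Suc n]"
        by (subst map_tl[symmetric]) (simp add: tl_upt del: upt_Suc)
      then show ?thesis
        by (simp only: set_map set_upt) (auto simp: less_Suc_eq_le)
    qed
    then have eq: "?H n = {\<omega>. s \<in> set (tl (map \<omega> [0..<Suc n]))}" by blast
    show ?thesis
      unfolding return_within_def eq
      by (rule measure_chain_law_path) (use H_sets[of n] eq in simp)
  qed
  ultimately show ?thesis by (simp add: return_prob_def)
qed

section \<open>Return probabilities against bounded superharmonic functions\<close>

lemma integrable_measure_pmf_bounded:
  fixes f :: "'s \<Rightarrow> real"
  assumes "\<And>x. \<bar>f x\<bar> \<le> B"
  shows "integrable (measure_pmf p) f"
  by (rule measure_pmf.integrable_const_bound[where B = B]) (use assms in auto)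

text \<open>Take for \<open>f\<close> the probability of ever visiting \<open>s\<close>, time 0
  included. Excluding time 0 gives the function \<open>r\<close> of the proof, which can differ from
  \<open>f\<close> only at \<open>s\<close>, where it is the return probability.\<close>

lemma hitting_prob_exists:
  obtains f :: "'s \<Rightarrow> real" where "\<And>x. 0 \<le> f x" "\<And>x. f x \<le> 1" "f s = 1"
    "\<And>x. x \<noteq> s \<Longrightarrow> (\<integral>y. f y \<partial>step_pmf S K x) = f x"
    "(\<integral>y. f y \<partial>step_pmf S K s) = return_prob S K s"
proof -
  let ?P = "step_pmf S K"
  let ?r = "return_within ?P s"
  have "\<exists>L. (\<lambda>n. ?r n x) \<longlonglongrightarrow> L" for x
    using incseq_convergent[of "\<lambda>n. ?r n x" 1] return_within_mono return_within_bounds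
    by (metis incseq_SucI)
  then obtain r where r: "\<And>x. (\<lambda>n. ?r n x) \<longlonglongrightarrow> r x" by metis
  have r_nonneg: "0 \<le> r x" for x
    by (rule LIMSEQ_le_const[OF r]) (simp add: return_within_bounds)
  have r_le_1: "r x \<le> 1" for x
    by (rule LIMSEQ_le_const2[OF r]) (simp add: return_within_bounds)
  let ?f = "\<lambda>y. if y = s then 1 else r y"
  have step: "(\<integral>y. ?f y \<partial>?P x) = r x" for x
  proof (rule LIMSEQ_unique)
    show "(\<lambda>n. ?r (Suc n) x) \<longlonglongrightarrow> r x"
      using r by (rule LIMSEQ_Suc)
    show "(\<lambda>n. ?r (Suc n) x) \<longlonglongrightarrow> (\<integral>y. ?f y \<partial>?P x)"
      unfolding return_within_Suc
    proof (rule integral_dominated_convergence[where w = "\<lambda>_. 1"])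
      show "AE y in ?P x. (\<lambda>n. if y = s then 1 else ?r n y) \<longlonglongrightarrow> ?f y"
        by (rule AE_I2) (simp add: r)
      show "AE y in ?P x. norm (if y = s then 1 else ?r n y) \<le> 1" for n
        by (rule AE_I2) (simp add: return_within_bounds)
    qed simp_all
  qed
  have "r s = return_prob S K s"
    using LIMSEQ_unique[OF r return_within_tendsto] .
  with r_nonneg r_le_1 step show ?thesis by (intro that[of ?f]) auto
qed

text \<open>Optional stopping: for a positive superharmonic \<open>g\<close>, stopping at the first
  visit to \<open>s\<close> after time 0 bounds the visiting probability times \<open>g s\<close> by
  the one-step mean of \<open>g\<close>, which is below \<open>g s\<close> at
  \<open>s\<close>.\<close>

lemma return_prob_less_1I:
  fixes f :: "'s \<Rightarrow> real"
  assumes bd: "\<And>x. \<bar>f x\<bar> \<le> B"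
    and super: "\<And>x. (\<integral>y. f y \<partial>step_pmf S K x) \<le> f x"
    and strict: "(\<integral>y. f y \<partial>step_pmf S K s) < f s"
  shows "return_prob S K s < 1"
proof -
  let ?P = "step_pmf S K"
  \<comment> \<open>Constants are harmonic, so the shift keeps all inequalities and makes the
    function positive.\<close>
  define g where "g x = f x + B + 1" for x
  have int_f: "integrable (?P x) f" for x
    using integrable_measure_pmf_bounded bd .
  have int_g: "integrable (?P x) g" for x
    unfolding g_def using int_f by auto
  have Eg: "(\<integral>y. g y \<partial>?P x) = (\<integral>y. f y \<partial>?P x) + B + 1" for x
    unfolding g_def using int_f by simp
  have g_pos: "0 < g x" for x
    using bd[of x] by (simp add: g_def abs_le_iff)
  have le: "return_within ?P s n x * g s \<le> (\<integral>y. g y \<partial>?P x)" for n x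
  proof (induction n arbitrary: x)
    case 0
    show ?case using g_pos by (simp add: return_within_0 less_imp_le)
  next
    case (Suc n)
    have "return_within ?P s (Suc n) x * g s
        = (\<integral>y. (if y = s then 1 else return_within ?P s n y) * g s \<partial>?P x)"
      by (simp add: return_within_Suc)
    also have "\<dots> \<le> (\<integral>y. g y \<partial>?P x)"
    proof (rule integral_mono)
      show "integrable (?P x) (\<lambda>y. (if y = s then 1 else return_within ?P s n y) * g s)"
        by (intro integrable_mult_left integrable_measure_pmf_bounded[where B = 1])
           (auto simp: return_within_bounds)
      show "(if y = s then 1 else return_within ?P s n y) * g s \<le> g y" for y
        using Suc[of y] Eg[of y] super[of y] by (auto simp: g_def)
    qed (rule int_g)
    finally show ?case .
  qed
  have "return_prob S K s * g s \<le> (\<integral>y. g y \<partial>?P s)"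
    by (rule LIMSEQ_le_const2[OF tendsto_mult_right[OF return_within_tendsto]]) (use le in blast)
  also have "\<dots> < g s" using strict by (simp add: Eg) (simp add: g_def)
  finally show ?thesis using g_pos[of s] by simp
qed

section \<open>Electrical networks\<close>

locale network =
  fixes E :: "'a set set" and c :: "'a \<Rightarrow> 'a \<Rightarrow> real"
  assumes finite_neighbours: "finite (neighbours E x)"
    and c_sym: "c x y = c y x"
    and c_nonneg: "0 \<le> c x y"
    and c_zero: "y \<notin> neighbours E x \<Longrightarrow> c x y = 0"
begin

definition flow :: "('a \<Rightarrow> real) \<Rightarrow> 'a \<Rightarrow> real" where
  "flow A x = (\<Sum>y\<in>neighbours E x. c x y * (A y - A x))"

definition strictly_superharmonic_at :: "'a \<Rightarrow> ('a \<Rightarrow> real) \<Rightarrow> bool" where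
  "strictly_superharmonic_at b A \<longleftrightarrow>
     (\<exists>B. \<forall>x. \<bar>A x\<bar> \<le> B) \<and> (\<forall>x. flow A x \<le> 0) \<and> flow A b < 0"

text \<open>Each edge counts in both orders, so this is twice the Dirichlet energy inside
  \<open>F\<close>.\<close>

definition energy :: "'a set \<Rightarrow> ('a \<Rightarrow> real) \<Rightarrow> real" where
  "energy F u = (\<Sum>x\<in>F. \<Sum>y\<in>F. c x y * (u x - u y)\<^sup>2)"

text \<open>By symmetry of \<open>c\<close> the two halves of \<open>g x - g y\<close> give equal
  sums. As \<open>F\<close> contains the neighbours of the support of \<open>g\<close>, the inner
  sum over \<open>F\<close> is the full flow wherever it matters.\<close>

lemma summation_by_parts:
  assumes "finite F" "\<And>x. g x \<noteq> 0 \<Longrightarrow> insert x (neighbours E x) \<subseteq> F"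
  shows "(\<Sum>x\<in>F. \<Sum>y\<in>F. c x y * (A x - A y) * (g x - g y)) = - 2 * (\<Sum>x\<in>F. g x * flow A x)"
proof -
  let ?S = "\<Sum>x\<in>F. \<Sum>y\<in>F. c x y * (A x - A y) * g x"
  have "(\<Sum>x\<in>F. \<Sum>y\<in>F. c x y * (A x - A y) * g y) = (\<Sum>y\<in>F. \<Sum>x\<in>F. c x y * (A x - A y) * g y)"
    by (rule sum.swap)
  also have "\<dots> = - ?S"
    unfolding sum_negf[symmetric] by (intro sum.cong refl) (simp add: c_sym algebra_simps)
  finally have "(\<Sum>x\<in>F. \<Sum>y\<in>F. c x y * (A x - A y) * (g x - g y)) = 2 * ?S"
    by (simp add: right_diff_distrib sum_subtractf)
  also have "?S = (\<Sum>x\<in>F. - (g x * flow A x))"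
  proof (rule sum.cong[OF refl])
    fix x assume "x \<in> F"
    show "(\<Sum>y\<in>F. c x y * (A x - A y) * g x) = - (g x * flow A x)"
    proof (cases "g x = 0")
      case False
      then have "neighbours E x \<subseteq> F" using assms(2) by auto
      then have "(\<Sum>y\<in>F. c x y * (A x - A y) * g x)
          = (\<Sum>y\<in>neighbours E x. c x y * (A x - A y) * g x)"
        using assms(1) by (intro sum.mono_neutral_right) (auto simp: c_zero)
      also have "\<dots> = - (g x * flow A x)"
        by (simp add: flow_def sum_distrib_left sum_negf[symmetric] algebra_simps)
      finally show ?thesis .
    qed simp
  qed
  finally show ?thesis by (simp add: sum_negf)
qed

text \<open>Ground state transform: for \<open>A > 0\<close> one has
  \<open>(u x - u y)\<^sup>2 \<ge> (A x - A y) (u x\<^sup>2 / A x - u y\<^sup>2 / A y)\<close>, and summing the right-hand side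
  by parts moves all differences onto \<open>A\<close>.\<close>

lemma energy_lower_bound:
  assumes "strictly_superharmonic_at b A"
  obtains k where "0 < k" "\<And>F u. finite F \<Longrightarrow> b \<in> F \<Longrightarrow>
    (\<And>x. u x \<noteq> 0 \<Longrightarrow> insert x (neighbours E x) \<subseteq> F) \<Longrightarrow> k * (u b)\<^sup>2 \<le> energy F u"
proof -
  obtain B where B: "\<And>x. \<bar>A x\<bar> \<le> B"
    using assms by (auto simp: strictly_superharmonic_at_def)
  define A' where "A' x = A x + B + 1" for x
  have pos: "0 < A' x" for x
    using B[of x] by (simp add: A'_def abs_le_iff)
  have flow_A': "flow A' x = flow A x" for x
    by (simp add: flow_def A'_def)
  have super: "flow A' x \<le> 0" "flow A' b < 0" for x
    using assms by (auto simp: strictly_superharmonic_at_def flow_A')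
  show ?thesis
  proof
    \<comment> \<open>This is the contribution of \<open>b\<close> to the sum after summation by
      parts; the other contributions are nonnegative and are dropped.\<close>
    show "0 < 2 * (- flow A' b) / A' b"
      by (intro divide_pos_pos mult_pos_pos) (use super pos in auto)
    fix F and u :: "'a \<Rightarrow> real"
    assume F: "finite F" "b \<in> F" and supp: "\<And>x. u x \<noteq> 0 \<Longrightarrow> insert x (neighbours E x) \<subseteq> F"
    have pt: "(A' x - A' y) * ((u x)\<^sup>2 / A' x - (u y)\<^sup>2 / A' y) \<le> (u x - u y)\<^sup>2" for x y
    proof -
      have "(u x - u y)\<^sup>2 - (A' x - A' y) * ((u x)\<^sup>2 / A' x - (u y)\<^sup>2 / A' y)
          = (u x * A' y - u y * A' x)\<^sup>2 / (A' x * A' y)"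
        using pos[of x] pos[of y] by (simp add: field_simps power2_eq_square)
      also have "\<dots> \<ge> 0" using pos[of x] pos[of y] by simp
      finally show ?thesis by simp
    qed
    have "2 * (- flow A' b) / A' b * (u b)\<^sup>2 = - 2 * ((u b)\<^sup>2 / A' b * flow A' b)"
      by simp
    also have "\<dots> \<le> - 2 * (\<Sum>x\<in>F. (u x)\<^sup>2 / A' x * flow A' x)"
    proof -
      have "(\<Sum>x\<in>F - {b}. (u x)\<^sup>2 / A' x * flow A' x) \<le> 0"
        using super pos by (intro sum_nonpos mult_nonneg_nonpos) (auto simp: less_imp_le)
      then show ?thesis by (simp add: sum.remove[OF F])
    qed
    also have "\<dots> = (\<Sum>x\<in>F. \<Sum>y\<in>F. c x y * (A' x - A' y) * ((u x)\<^sup>2 / A' x - (u y)\<^sup>2 / A' y))"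
      by (rule summation_by_parts[symmetric, OF F(1)]) (use supp in auto)
    also have "\<dots> \<le> energy F u"
      unfolding energy_def mult.assoc by (intro sum_mono mult_left_mono pt c_nonneg)
    finally show "2 * (- flow A' b) / A' b * (u b)\<^sup>2 \<le> energy F u" .
  qed
qed

section \<open>Truncated Green functions and comparison of networks\<close>

definition avg :: "('a \<Rightarrow> real) \<Rightarrow> 'a \<Rightarrow> real" where
  "avg f x = (\<Sum>y\<in>neighbours E x. c x y * f y) / (\<Sum>y\<in>neighbours E x. c x y)"

lemma sum_c_nonneg: "0 \<le> (\<Sum>y\<in>neighbours E x. c x y)"
  by (simp add: sum_nonneg c_nonneg)

lemma flow_eq_avg: "flow f x = (\<Sum>y\<in>neighbours E x. c x y) * (avg f x - f x)"
proof (cases "(\<Sum>y\<in>neighbours E x. c x y) = 0")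
  case True
  then have "\<forall>y\<in>neighbours E x. c x y = 0"
    using sum_nonneg_eq_0_iff[OF finite_neighbours, of x "c x"] c_nonneg by simp
  then show ?thesis by (simp add: flow_def)
next
  case False
  have "flow f x = (\<Sum>y\<in>neighbours E x. c x y * f y) - (\<Sum>y\<in>neighbours E x. c x y) * f x"
    by (simp add: flow_def right_diff_distrib sum_subtractf sum_distrib_right)
  then show ?thesis
    using False by (simp add: avg_def right_diff_distrib)
qed

lemma avg_mono: "(\<And>x. f x \<le> g x) \<Longrightarrow> avg f x \<le> avg g x"
  unfolding avg_def by (intro divide_right_mono sum_mono mult_left_mono c_nonneg sum_c_nonneg)

text \<open>Equality fails where the total conductance is 0, since \<open>avg\<close> is then 0 by
  division by zero.\<close>

lemma avg_const_le: "0 \<le> a \<Longrightarrow> avg (\<lambda>_. a) x \<le> a"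
  by (simp add: avg_def sum_distrib_right[symmetric])

text \<open>The expected number of visits to \<open>b\<close> up to time \<open>n\<close> for the
  network walk started at \<open>x\<close>, killed at vertices of total conductance 0.\<close>

primrec green :: "'a \<Rightarrow> nat \<Rightarrow> 'a \<Rightarrow> real" where
  "green b 0 x = of_bool (x = b)"
| "green b (Suc n) x = of_bool (x = b) + avg (green b n) x"

lemma green_nonneg: "0 \<le> green b n x"
proof (induction n arbitrary: x)
  case (Suc n)
  then have "0 \<le> avg (green b n) x"
    unfolding avg_def by (intro divide_nonneg_nonneg sum_nonneg mult_nonneg_nonneg c_nonneg)
  then show ?case by simp
qed simp

lemma green_mono: "green b n x \<le> green b (Suc n) x"
proof (induction n arbitrary: x)
  case 0
  have "0 \<le> avg (green b 0) x"
    unfolding avg_def by (intro divide_nonneg_nonneg sum_nonneg mult_nonneg_nonneg c_nonneg green_nonneg)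
  then show ?case by simp
next
  case (Suc n)
  then show ?case using avg_mono[of "green b n" "green b (Suc n)" x] by simp
qed

lemma finite_support_green: "finite {x. green b n x \<noteq> 0}"
proof (induction n)
  case (Suc n)
  have "{x. green b (Suc n) x \<noteq> 0} \<subseteq> insert b (\<Union>y\<in>{y. green b n y \<noteq> 0}. neighbours E y)"
  proof
    fix x assume "x \<in> {x. green b (Suc n) x \<noteq> 0}"
    then consider "x = b" | "avg (green b n) x \<noteq> 0" by (cases "x = b") auto
    then show "x \<in> insert b (\<Union>y\<in>{y. green b n y \<noteq> 0}. neighbours E y)"
    proof cases
      case 2
      then obtain y where "y \<in> neighbours E x" "green b n y \<noteq> 0"
        unfolding avg_def by (metis (no_types, lifting) div_0 mult_zero_right sum.neutral)
      then show ?thesis by (auto simp: neighbours_def insert_commute)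
    qed simp
  qed
  then show ?case
    by (rule finite_subset) (use Suc finite_neighbours in auto)
qed simp

text \<open>Monotonicity in \<open>n\<close> gives \<open>u - avg u \<le> \<delta>\<^sub>b\<close>
  for \<open>u = green b n\<close>, so after summation by parts only the term at \<open>b\<close>
  remains.\<close>

lemma energy_green:
  assumes "finite F" "b \<in> F" "\<And>x. green b n x \<noteq> 0 \<Longrightarrow> insert x (neighbours E x) \<subseteq> F"
  shows "energy F (green b n) \<le> 2 * green b n b * (\<Sum>y\<in>neighbours E b. c b y)"
proof -
  let ?u = "green b n" and ?\<pi> = "\<lambda>x. \<Sum>y\<in>neighbours E x. c x y"
  have "energy F ?u = (\<Sum>x\<in>F. \<Sum>y\<in>F. c x y * (?u x - ?u y) * (?u x - ?u y))"
    by (simp add: energy_def power2_eq_square mult.assoc)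
  also have "\<dots> = 2 * (\<Sum>x\<in>F. ?u x * - flow ?u x)"
    using summation_by_parts[OF assms(1,3)] by (simp add: sum_negf)
  also have "\<dots> \<le> 2 * (\<Sum>x\<in>F. if x = b then ?u x * ?\<pi> x else 0)"
  proof (intro mult_left_mono sum_mono)
    fix x
    have "?u x - avg ?u x \<le> of_bool (x = b)"
      using green_mono[of b n x] by simp
    then have "?u x * (?\<pi> x * (?u x - avg ?u x)) \<le> ?u x * (?\<pi> x * of_bool (x = b))"
      by (intro mult_left_mono green_nonneg sum_c_nonneg)
    then show "?u x * - flow ?u x \<le> (if x = b then ?u x * ?\<pi> x else 0)"
      by (cases "x = b") (simp_all add: flow_eq_avg algebra_simps)
  qed simp
  also have "\<dots> = 2 * ?u b * ?\<pi> b" using assms(1,2) by simp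
  finally show ?thesis .
qed

text \<open>The Green function is bounded only at \<open>b\<close> so far, hence the cutoff at its
  limit \<open>m\<close> there: taking the minimum with a constant preserves superharmonicity and
  leaves the values at \<open>b\<close> unchanged.\<close>

lemma strictly_superharmonic_if_green_bounded:
  assumes M: "\<And>n. green b n b \<le> M" and nz: "(\<Sum>y\<in>neighbours E b. c b y) \<noteq> 0"
  shows "\<exists>A. strictly_superharmonic_at b A"
proof -
  have "\<exists>L. (\<lambda>n. green b n b) \<longlonglongrightarrow> L"
    using incseq_convergent[of "\<lambda>n. green b n b" M] M green_mono by (metis incseq_SucI)
  then obtain m where m: "(\<lambda>n. green b n b) \<longlonglongrightarrow> m" by blast
  have le_m: "green b n b \<le> m" for n
    using incseq_le[OF incseq_SucI m] green_mono by blast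
  have m0: "0 \<le> m" using le_m[of 0] by simp
  define v where "v n x = min (green b n x) m" for n x
  have v_bds: "0 \<le> v n x" "v n x \<le> m" for n x
    using green_nonneg m0 by (auto simp: v_def)
  have v_inc: "v n x \<le> v (Suc n) x" for n x
    using green_mono[of b n x] unfolding v_def by (intro min.mono) auto
  have "\<exists>L. (\<lambda>n. v n x) \<longlonglongrightarrow> L" for x
    using incseq_convergent[of "\<lambda>n. v n x" m] v_inc v_bds by (metis incseq_SucI)
  then obtain A where A: "\<And>x. (\<lambda>n. v n x) \<longlonglongrightarrow> A x" by metis
  have A_bds: "0 \<le> A x" "A x \<le> m" for x
    using LIMSEQ_le_const[OF A] LIMSEQ_le_const2[OF A] v_bds by blast+
  have "v n b = green b n b" for n
    using le_m by (simp add: v_def)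
  then have A_b: "A b = m"
    using LIMSEQ_unique[OF A[of b]] m by simp
  have avg_A: "(\<lambda>n. avg (v n) x) \<longlonglongrightarrow> avg A x" for x
  proof (cases "(\<Sum>y\<in>neighbours E x. c x y) = 0")
    case False
    then show ?thesis unfolding avg_def by (intro tendsto_intros A)
  qed (simp add: avg_def)
  have le_green: "avg (v n) x \<le> avg (green b n) x" for n x
    by (rule avg_mono) (simp add: v_def)
  have "avg (v n) x \<le> v (Suc n) x" for n x
  proof -
    have "avg (v n) x \<le> m"
      using avg_mono[of "v n" "\<lambda>_. m" x] avg_const_le[OF m0, of x] v_bds by simp
    moreover have "avg (v n) x \<le> green b (Suc n) x" using le_green[of n x] by (cases "x = b") simp_all
    ultimately show ?thesis by (simp only: v_def min.bounded_iff)
  qed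
  then have "avg A x \<le> A x" for x
    using LIMSEQ_le[OF avg_A LIMSEQ_Suc[OF A]] by blast
  then have "flow A x \<le> 0" for x
    unfolding flow_eq_avg by (intro mult_nonneg_nonpos sum_c_nonneg) simp
  moreover have "flow A b < 0"
  proof -
    \<comment> \<open>The unit charge in the recursion for \<open>green\<close> forces a drop of 1
      at \<open>b\<close>, which survives in the limit.\<close>
    have "avg (v n) b \<le> m - 1" for n
      using le_green[of n b] le_m[of "Suc n"] by simp
    then have "avg A b \<le> m - 1" using LIMSEQ_le_const2[OF avg_A] by blast
    then show ?thesis
      unfolding flow_eq_avg using A_b nz sum_c_nonneg[of b]
      by (intro mult_pos_neg) (auto simp: less_le)
  qed
  moreover have "\<exists>B. \<forall>x. \<bar>A x\<bar> \<le> B" using A_bds by (auto intro!: exI[of _ m])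
  ultimately show ?thesis by (auto simp: strictly_superharmonic_at_def)
qed

end

text \<open>For the Green function of \<open>c'\<close>, the lower energy bound coming from
  \<open>c\<close> is quadratic in its value at \<open>b\<close> and the upper bound is linear, so
  that value is bounded in \<open>n\<close>.\<close>

lemma rayleigh_monotonicity:
  assumes "network E c" "network E c'"
    and le: "\<And>x y. c x y \<le> C * c' x y"
    and ex: "\<exists>A. network.strictly_superharmonic_at E c b A"
  shows "\<exists>A. network.strictly_superharmonic_at E c' b A"
proof -
  interpret N: network E c by fact
  interpret N': network E c' by fact
  let ?\<pi> = "\<Sum>y\<in>neighbours E b. c' b y"
  obtain A where A: "N.strictly_superharmonic_at b A" using ex by blast
  obtain k where k: "0 < k" and bound: "\<And>F u. finite F \<Longrightarrow> b \<in> F \<Longrightarrow>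
      (\<And>x. u x \<noteq> 0 \<Longrightarrow> insert x (neighbours E x) \<subseteq> F) \<Longrightarrow> k * (u b)\<^sup>2 \<le> N.energy F u"
    using N.energy_lower_bound[OF A] by metis
  \<comment> \<open>Strictness at \<open>b\<close> forces an edge of positive conductance there,
    which yields both \<open>0 < C\<close> and a nonzero total conductance of \<open>c'\<close> at
    \<open>b\<close>.\<close>
  obtain y where "c b y \<noteq> 0"
  proof -
    have "N.flow A b \<noteq> 0" using A by (auto simp: N.strictly_superharmonic_at_def)
    then obtain y where "c b y * (A y - A b) \<noteq> 0"
      unfolding N.flow_def by (metis (no_types, lifting) sum.neutral)
    then show ?thesis using that by auto
  qed
  then have "y \<in> neighbours E b" "0 < C * c' b y"
    using N.c_zero[of y b] N.c_nonneg[of b y] le[of b y] by (auto simp: less_le)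
  with N'.c_nonneg[of b y] have C: "0 < C" and c'_pos: "0 < c' b y"
    by (auto simp: zero_less_mult_iff)
  have nz: "?\<pi> \<noteq> 0"
    using \<open>y \<in> neighbours E b\<close> c'_pos N'.c_nonneg sum_nonneg_eq_0_iff[OF N.finite_neighbours, of b "c' b"]
    by fastforce
  have "N'.green b n b \<le> 2 * C * ?\<pi> / k" for n
  proof -
    let ?u = "N'.green b n"
    define F where "F = insert b (\<Union>x\<in>{x. ?u x \<noteq> 0}. insert x (neighbours E x))"
    have F: "finite F" "b \<in> F" "\<And>x. ?u x \<noteq> 0 \<Longrightarrow> insert x (neighbours E x) \<subseteq> F"
      using N'.finite_support_green N.finite_neighbours by (auto simp: F_def)
    have "k * (?u b)\<^sup>2 \<le> N.energy F ?u" by (rule bound[OF F])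
    also have "\<dots> \<le> C * N'.energy F ?u"
      unfolding N.energy_def N'.energy_def sum_distrib_left mult.assoc[symmetric]
      by (intro sum_mono mult_right_mono le) simp
    also have "\<dots> \<le> C * (2 * ?u b * ?\<pi>)"
      using N'.energy_green[OF F] C by (intro mult_left_mono) auto
    finally have "?u b * (k * ?u b) \<le> ?u b * (2 * C * ?\<pi>)"
      by (simp add: power2_eq_square mult_ac)
    moreover have "0 < ?u b"
    proof (cases n)
      case (Suc m)
      have "0 \<le> N'.avg (N'.green b m) b"
        using N'.green_mono[of b 0 b] N'.avg_mono[of "\<lambda>_. 0" "N'.green b m" b] N'.green_nonneg
        by (simp add: N'.avg_def)
      then show ?thesis by (simp add: Suc)
    qed simp
    ultimately show ?thesis using k by (simp add: field_simps)
  qed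
  then show ?thesis by (rule N'.strictly_superharmonic_if_green_bounded) (rule nz)
qed

section \<open>The backtracking walk as a network\<close>

text \<open>A zero row does not sum to 1. This covers isolated vertices and points outside the state
  space, where every function is thus harmonic.\<close>

lemma step_pmf_absorbing:
  assumes "\<And>y. trans_row S K x y = 0"
  shows "step_pmf S K x = return_pmf x"
  using assms by (simp add: step_pmf_def stochastic_row_def)

text \<open>On functions on the edges leaving \<open>x\<close>, resampling the edge with backtracking probability \<open>p\<close>
  has eigenvalue 1 on constants and \<open>vertex_bias E p x\<close> on functions of mean zero. At a leaf
  the latter space is trivial and the value 0 is a convention.\<close>

definition vertex_bias :: "'a set set \<Rightarrow> real \<Rightarrow> 'a \<Rightarrow> real" where
  "vertex_bias E p x = (if deg E x \<le> 1 then 0 else p - (1 - p) / (real (deg E x) - 1))"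

text \<open>Eliminating the edge values leads to
  \<open>(1 - l w) * (A w - A y) / (1 - l y * l w)\<close> for \<open>f (y, w) - A y\<close>, where
  \<open>l\<close> is the bias; the factor \<open>1 - l y\<close> makes the coefficient
  symmetric.\<close>

definition brw_conductance :: "'a set set \<Rightarrow> real \<Rightarrow> 'a \<Rightarrow> 'a \<Rightarrow> real" where
  "brw_conductance E p x y = of_bool ({x, y} \<in> E) *
     ((1 - vertex_bias E p x) * (1 - vertex_bias E p y) / (1 - vertex_bias E p x * vertex_bias E p y))"

section \<open>Uniform bounds on biases and conductances\<close>

locale brw_graph =
  fixes V :: "'a set" and E :: "'a set set" and p :: real
  assumes simple: "simple_graph V E" and bounded: "bounded_degree V E"
    and p: "0 < p" "p < 1"
begin

abbreviation l :: "'a \<Rightarrow> real" where "l \<equiv> vertex_bias E p"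

text \<open>From degree 2 on, the bias lies between \<open>2 * p - 1\<close>, its value at degree 2,
  and \<open>p\<close>, its limit for large degrees.\<close>

definition bias_bound :: real where "bias_bound = max p \<bar>2 * p - 1\<bar>"

lemma edge_in_V: "{x, y} \<in> E \<Longrightarrow> x \<in> V \<and> y \<in> V \<and> x \<noteq> y"
  using simple by (force simp: simple_graph_def doubleton_eq_iff)

lemma finite_neighbours: "finite (neighbours E x)"
proof (cases "x \<in> V")
  case True
  then show ?thesis using bounded by (auto simp: bounded_degree_def)
next
  case False
  then have "neighbours E x = {}" using edge_in_V by (auto simp: neighbours_def)
  then show ?thesis by simp
qed

lemma deg_pos: "y \<in> neighbours E x \<Longrightarrow> 0 < deg E x"
  using finite_neighbours by (auto simp: deg_def card_gt_0_iff)

lemma bias_bound: "0 < bias_bound" "bias_bound < 1"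
  using p by (auto simp: bias_bound_def)

lemma abs_l_le: "\<bar>l x\<bar> \<le> bias_bound"
proof (cases "deg E x \<le> 1")
  case True
  then show ?thesis using p by (simp add: vertex_bias_def bias_bound_def)
next
  case False
  define q where "q = (1 - p) / (real (deg E x) - 1)"
  have "0 \<le> q" "q \<le> 1 - p"
    using False p by (auto simp: q_def divide_le_eq mult_le_cancel_left1)
  moreover have "l x = p - q" using False by (simp add: vertex_bias_def q_def)
  ultimately show ?thesis unfolding bias_bound_def by linarith
qed

lemma l_bounds: "- 1 < l x" "l x < 1" "1 - bias_bound \<le> 1 - l x" "1 - l x \<le> 2"
  using abs_l_le[of x] bias_bound by linarith+

lemma bias_bound_square: "0 < 1 - bias_bound\<^sup>2"
  using power_strict_mono[of bias_bound 1 2] bias_bound by simp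

lemma l_mult_bounds: "1 - bias_bound\<^sup>2 \<le> 1 - l x * l y" "1 - l x * l y \<le> 2" "0 < 1 - l x * l y"
proof -
  have "\<bar>l x * l y\<bar> \<le> bias_bound\<^sup>2"
    unfolding abs_mult power2_eq_square using bias_bound by (intro mult_mono abs_l_le) auto
  moreover have "bias_bound\<^sup>2 < 1"
    using bias_bound_square by simp
  ultimately show "1 - bias_bound\<^sup>2 \<le> 1 - l x * l y" "1 - l x * l y \<le> 2" "0 < 1 - l x * l y"
    by linarith+
qed

sublocale unit: network E "\<lambda>x y. of_bool ({x, y} \<in> E)"
  by unfold_locales (auto simp: finite_neighbours, auto simp: neighbours_def insert_commute)

sublocale biased: network E "brw_conductance E p"
proof
  show "brw_conductance E p x y = brw_conductance E p y x" for x y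
    by (simp add: brw_conductance_def insert_commute mult.commute)
  show "0 \<le> brw_conductance E p x y" for x y
    using l_bounds(2)[of x] l_bounds(2)[of y] l_mult_bounds(3)[of x y]
    by (simp add: brw_conductance_def)
  show "brw_conductance E p x y = 0" if "y \<notin> neighbours E x" for x y
    using that by (simp add: brw_conductance_def neighbours_def)
qed (rule finite_neighbours)

lemma brw_conductance_le:
  "brw_conductance E p x y \<le> 4 / (1 - bias_bound\<^sup>2) * of_bool ({x, y} \<in> E)"
proof -
  have "(1 - l x) * (1 - l y) \<le> 2 * 2"
    using l_bounds[of x] l_bounds[of y] by (intro mult_mono) auto
  then have "(1 - l x) * (1 - l y) / (1 - l x * l y) \<le> 4 / (1 - bias_bound\<^sup>2)"
    using bias_bound_square l_mult_bounds(1)[of x y] by (intro frac_le) auto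
  then show ?thesis by (simp add: brw_conductance_def)
qed

lemma le_brw_conductance:
  "of_bool ({x, y} \<in> E) \<le> 2 / (1 - bias_bound)\<^sup>2 * brw_conductance E p x y"
proof -
  have "(1 - bias_bound) * (1 - bias_bound) \<le> (1 - l x) * (1 - l y)"
    using l_bounds[of x] l_bounds[of y] bias_bound by (intro mult_mono) auto
  then have le: "(1 - bias_bound)\<^sup>2 / 2 \<le> (1 - l x) * (1 - l y) / (1 - l x * l y)"
    using l_mult_bounds[of x y] l_bounds(2)[of x] l_bounds(2)[of y]
    by (intro frac_le) (auto simp: power2_eq_square)
  have k: "0 < (1 - bias_bound)\<^sup>2" using bias_bound by simp
  have "1 = 2 / (1 - bias_bound)\<^sup>2 * ((1 - bias_bound)\<^sup>2 / 2)" using k by simp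
  also have "\<dots> \<le> 2 / (1 - bias_bound)\<^sup>2 * ((1 - l x) * (1 - l y) / (1 - l x * l y))"
    using k by (intro mult_left_mono[OF le]) simp
  finally show ?thesis by (simp add: brw_conductance_def)
qed

lemma superharmonic_unit_iff_biased:
  "(\<exists>A. unit.strictly_superharmonic_at b A) \<longleftrightarrow> (\<exists>A. biased.strictly_superharmonic_at b A)"
proof
  show "\<exists>A. biased.strictly_superharmonic_at b A" if "\<exists>A. unit.strictly_superharmonic_at b A"
    by (rule rayleigh_monotonicity[OF unit.network_axioms biased.network_axioms
          le_brw_conductance that])
  show "\<exists>A. unit.strictly_superharmonic_at b A" if "\<exists>A. biased.strictly_superharmonic_at b A"
    by (rule rayleigh_monotonicity[OF biased.network_axioms unit.network_axioms
          brw_conductance_le that])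
qed

section \<open>Simple random walk and the unit network\<close>

lemma unit_flow_eq:
  "unit.flow f x = real (deg E x) * ((\<integral>y. f y \<partial>step_pmf V (srw E) x) - f x)"
proof (cases "neighbours E x = {}")
  case True
  then show ?thesis by (simp add: unit.flow_def deg_def)
next
  case False
  then obtain y where y: "y \<in> neighbours E x" by blast
  then have "x \<in> V" using edge_in_V by (auto simp: neighbours_def)
  then have st: "stochastic_row V (srw E) x"
    using stochastic_row_srw[OF simple bounded] False by blast
  have "(\<integral>y. f y \<partial>step_pmf V (srw E) x) = (\<Sum>y\<in>neighbours E x. f y * pmf (step_pmf V (srw E) x) y)"
    by (rule integral_measure_pmf_real[OF finite_neighbours])
       (auto simp: set_pmf_iff pmf_step_pmf[OF st] trans_row_def srw_def neighbours_def split: if_splits)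
  also have "\<dots> = (\<Sum>y\<in>neighbours E x. f y / real (deg E x))"
    using edge_in_V
    by (intro sum.cong) (auto simp: pmf_step_pmf[OF st] trans_row_def srw_def neighbours_def)
  finally have "(\<integral>y. f y \<partial>step_pmf V (srw E) x) = (\<Sum>y\<in>neighbours E x. f y) / real (deg E x)"
    by (simp add: sum_divide_distrib)
  moreover have "unit.flow f x = (\<Sum>y\<in>neighbours E x. f y - f x)"
    unfolding unit.flow_def by (intro sum.cong) (auto simp: neighbours_def)
  ultimately show ?thesis
    using deg_pos[OF y] by (simp add: sum_subtractf deg_def right_diff_distrib)
qed

lemma srw_return_prob_iff:
  "return_prob V (srw E) b < 1 \<longleftrightarrow> (\<exists>A. unit.strictly_superharmonic_at b A)"
proof
  assume *: "return_prob V (srw E) b < 1"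
  obtain f where f: "\<And>x. 0 \<le> f x" "\<And>x. f x \<le> 1" "f b = 1"
    "\<And>x. x \<noteq> b \<Longrightarrow> (\<integral>y. f y \<partial>step_pmf V (srw E) x) = f x"
    "(\<integral>y. f y \<partial>step_pmf V (srw E) b) = return_prob V (srw E) b"
    by (rule hitting_prob_exists[where s = b and S = V and K = "srw E"]) (rule that)
  \<comment> \<open>An isolated \<open>b\<close> would be absorbing, with return probability
    1.\<close>
  have "neighbours E b \<noteq> {}"
  proof
    assume "neighbours E b = {}"
    then have "step_pmf V (srw E) b = return_pmf b"
      by (intro step_pmf_absorbing) (auto simp: trans_row_def srw_def neighbours_def)
    then show False using f(3,5) * by simp
  qed
  then have "0 < deg E b" using deg_pos by blast
  then have "unit.flow f b < 0"
    unfolding unit_flow_eq using f(3,5) * by (simp add: mult_pos_neg)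
  moreover have "unit.flow f x \<le> 0" for x
    unfolding unit_flow_eq using f(3-5) * by (cases "x = b") (auto intro: mult_nonneg_nonpos)
  moreover have "\<forall>x. \<bar>f x\<bar> \<le> 1" using f(1,2) by auto
  ultimately show "\<exists>A. unit.strictly_superharmonic_at b A"
    by (auto simp: unit.strictly_superharmonic_at_def)
next
  assume "\<exists>A. unit.strictly_superharmonic_at b A"
  then obtain A B where A: "\<And>x. \<bar>A x\<bar> \<le> B" "\<And>x. unit.flow A x \<le> 0" "unit.flow A b < 0"
    by (auto simp: unit.strictly_superharmonic_at_def)
  show "return_prob V (srw E) b < 1"
  proof (rule return_prob_less_1I[OF A(1)])
    show "(\<integral>y. A y \<partial>step_pmf V (srw E) b) < A b"
      using A(3) by (auto simp: unit_flow_eq mult_less_0_iff)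
    show "(\<integral>y. A y \<partial>step_pmf V (srw E) x) \<le> A x" for x
    proof (cases "neighbours E x = {}")
      case True
      then have "step_pmf V (srw E) x = return_pmf x"
        by (intro step_pmf_absorbing) (auto simp: trans_row_def srw_def neighbours_def)
      then show ?thesis by simp
    next
      case False
      then have "0 < deg E x" using deg_pos by blast
      then show ?thesis using A(2)[of x] by (simp add: unit_flow_eq mult_le_0_iff)
    qed
  qed
qed

section \<open>The backtracking walk and the biased network\<close>

text \<open>The step law combines the uniform law on the edges leaving \<open>y\<close> and the
  reversal, with weights \<open>1 - l y\<close> and \<open>l y\<close>; the latter may be
  negative.\<close>

lemma brw_step_expectation:
  assumes "{x, y} \<in> E"
  shows "(\<integral>e. f e \<partial>step_pmf (directed_edges E) (brw E p) (x, y))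
    = (1 - l y) * ((\<Sum>w\<in>neighbours E y. f (y, w)) / real (deg E y)) + l y * f (y, x)"
proof -
  let ?S = "directed_edges E" and ?N = "neighbours E y"
  have xN: "x \<in> ?N" using assms by (simp add: neighbours_def insert_commute)
  have st: "stochastic_row ?S (brw E p) (x, y)"
    using stochastic_row_brw[OF simple bounded p] assms by (simp add: directed_edges_def)
  have "(\<integral>e. f e \<partial>step_pmf ?S (brw E p) (x, y))
      = (\<Sum>e\<in>Pair y ` ?N. f e * pmf (step_pmf ?S (brw E p) (x, y)) e)"
  proof (rule integral_measure_pmf_real)
    fix e assume "e \<in> set_pmf (step_pmf ?S (brw E p) (x, y))"
    then have "e \<in> ?S" "brw E p (x, y) e \<noteq> 0"
      by (auto simp: set_pmf_iff pmf_step_pmf[OF st] trans_row_def simp del: brw.simps split: if_splits)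
    then show "e \<in> Pair y ` ?N"
      by (cases e, cases "fst e = y") (auto simp: neighbours_def directed_edges_def)
  qed (simp add: finite_neighbours)
  also have "\<dots> = (\<Sum>w\<in>?N. f (y, w) * brw E p (x, y) (y, w))"
  proof -
    have "pmf (step_pmf ?S (brw E p) (x, y)) (y, w) = brw E p (x, y) (y, w)" if "w \<in> ?N" for w
    proof -
      have "(x, y) \<in> ?S" "(y, w) \<in> ?S"
        using that assms by (auto simp: neighbours_def directed_edges_def)
      then show ?thesis by (simp add: pmf_step_pmf[OF st] trans_row_def del: brw.simps)
    qed
    then show ?thesis
      by (subst sum.reindex) (auto simp: inj_on_def simp del: brw.simps intro!: sum.cong)
  qed
  also have "\<dots> = (\<Sum>w\<in>?N. f (y, w) * ((1 - l y) / real (deg E y) + l y * of_bool (w = x)))"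
  proof (intro sum.cong refl arg_cong2[where f = "(*)"])
    fix w assume w: "w \<in> ?N"
    show "brw E p (x, y) (y, w) = (1 - l y) / real (deg E y) + l y * of_bool (w = x)"
    \<comment> \<open>At a leaf the uniform law is itself the reversal, in agreement with
      \<open>l y = 0\<close>.\<close>
    proof (cases "deg E y = 1")
      case True
      then have "w = x" using w xN by (auto simp: deg_def card_1_singleton_iff)
      then show ?thesis using True by (simp add: vertex_bias_def)
    next
      case False
      then have d: "1 < real (deg E y)" using deg_pos[OF xN] by simp
      then have "(1 - l y) / real (deg E y) = (1 - p) / (real (deg E y) - 1)"
        by (simp add: vertex_bias_def field_simps)
      then show ?thesis using d False by (simp add: vertex_bias_def)
    qed
  qed
  also have "\<dots> = (\<Sum>w\<in>?N. f (y, w) * ((1 - l y) / real (deg E y)))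
      + (\<Sum>w\<in>?N. if w = x then l y * f (y, w) else 0)"
    by (subst sum.distrib[symmetric]) (auto intro!: sum.cong simp: algebra_simps)
  also have "\<dots> = (1 - l y) * ((\<Sum>w\<in>?N. f (y, w)) / real (deg E y)) + l y * f (y, x)"
    using xN finite_neighbours by (simp add: sum_distrib_left sum_divide_distrib mult_ac)
  finally show ?thesis .
qed

lemma brw_step_absorbing:
  "e \<notin> directed_edges E \<Longrightarrow> step_pmf (directed_edges E) (brw E p) e = return_pmf e"
  by (rule step_pmf_absorbing) (simp add: trans_row_def)

text \<open>If \<open>f\<close> is harmonic for the \<open>p\<close>-BRW and \<open>A y\<close> is the average of \<open>f\<close> over the edges leaving
  \<open>y\<close>, then \<open>f (x, y) = (1 - l y) * A y + l y * f (y, x)\<close>. Solving this together with the same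
  equation for the reversed edge expresses \<open>f\<close> through \<open>A\<close>, and the definition of \<open>A\<close> turns into
  harmonicity for the conductances \<^const>\<open>brw_conductance\<close>.\<close>

lemma brw_return_prob_less_1I:
  assumes A: "biased.strictly_superharmonic_at b A" and ab: "{a, b} \<in> E"
  shows "return_prob (directed_edges E) (brw E p) (a, b) < 1"
proof -
  obtain B where B: "\<And>x. \<bar>A x\<bar> \<le> B"
    using A by (auto simp: biased.strictly_superharmonic_at_def)
  \<comment> \<open>Here \<open>A\<close> comes first and need not be the average of
    \<open>f\<close> over the edges leaving a vertex; the discrepancy is what
    \<open>biased.flow A\<close> measures.\<close>
  define f where "f e = (case e of (x, y) \<Rightarrow>
    ((1 - l y) * A y + l y * (1 - l x) * A x) / (1 - l x * l y))" for e
  have f_le: "\<bar>f e\<bar> \<le> (2 * B + 2 * B) / (1 - bias_bound\<^sup>2)" for e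
  proof (cases e)
    case (Pair x y)
    have "\<bar>(1 - l y) * A y + l y * (1 - l x) * A x\<bar>
        \<le> \<bar>1 - l y\<bar> * \<bar>A y\<bar> + \<bar>l y\<bar> * \<bar>1 - l x\<bar> * \<bar>A x\<bar>"
      by (metis abs_mult abs_triangle_ineq)
    also have "\<dots> \<le> 2 * B + 1 * 2 * B"
      using l_bounds[of x] l_bounds[of y] by (intro add_mono mult_mono B) auto
    finally have "\<bar>(1 - l y) * A y + l y * (1 - l x) * A x\<bar> \<le> 2 * B + 2 * B" by simp
    then have "\<bar>(1 - l y) * A y + l y * (1 - l x) * A x\<bar> / (1 - l x * l y)
        \<le> (2 * B + 2 * B) / (1 - bias_bound\<^sup>2)"
      using bias_bound_square l_mult_bounds(1)[of x y] by (intro frac_le) auto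
    then show ?thesis
      using l_mult_bounds(3)[of x y] by (simp add: f_def Pair)
  qed
  \<comment> \<open>The drift at an edge depends only on its head, because \<open>f_eq\<close>
    cancels the reversal term \<open>l y * f (y, x)\<close>.\<close>
  have step: "real (deg E y) * ((\<integral>e. f e \<partial>step_pmf (directed_edges E) (brw E p) (x, y)) - f (x, y))
      = biased.flow A y" if xy: "{x, y} \<in> E" for x y
  proof -
    have d: "0 < deg E y" using xy deg_pos[of x y] by (simp add: neighbours_def insert_commute)
    have f_eq: "f (x, y) = (1 - l y) * A y + l y * f (y, x)"
      using l_mult_bounds(3)[of x y] l_mult_bounds(3)[of y x]
      by (simp add: f_def field_simps)
    have "biased.flow A y = (\<Sum>w\<in>neighbours E y. (1 - l y) * (f (y, w) - A y))"
      unfolding biased.flow_def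
    proof (intro sum.cong refl)
      fix w assume "w \<in> neighbours E y"
      then show "brw_conductance E p y w * (A w - A y) = (1 - l y) * (f (y, w) - A y)"
        using l_mult_bounds(3)[of y w]
        by (simp add: brw_conductance_def neighbours_def f_def divide_simps) (simp add: algebra_simps)
    qed
    also have "\<dots> = (1 - l y) * ((\<Sum>w\<in>neighbours E y. f (y, w)) - real (deg E y) * A y)"
      by (simp add: sum_distrib_left[symmetric] sum_subtractf deg_def)
    finally have flow_eq: "biased.flow A y = \<dots>" .
    show ?thesis
      unfolding brw_step_expectation[OF xy] f_eq flow_eq using d by (simp add: field_simps)
  qed
  show ?thesis
  proof (rule return_prob_less_1I[OF f_le])
    show "(\<integral>e. f e \<partial>step_pmf (directed_edges E) (brw E p) (a, b)) < f (a, b)"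
      using step[OF ab] A by (auto simp: biased.strictly_superharmonic_at_def mult_less_0_iff
          dest!: sym[of "_ * _"])
    show "(\<integral>e. f e \<partial>step_pmf (directed_edges E) (brw E p) e') \<le> f e'" for e'
    proof (cases "e' \<in> directed_edges E")
      case True
      then obtain x y where e': "e' = (x, y)" and xy: "{x, y} \<in> E"
        by (auto simp: directed_edges_def)
      have d: "0 < deg E y" using xy deg_pos[of x y] by (simp add: neighbours_def insert_commute)
      have "biased.flow A y \<le> 0" using A by (simp add: biased.strictly_superharmonic_at_def)
      then show ?thesis
        using d unfolding step[OF xy, symmetric] e' by (simp add: mult_le_0_iff)
    qed (simp add: brw_step_absorbing)
  qed
qed

text \<open>The charge \<open>h\<close> is made symmetric under reversal of edges, because a charge \<open>h\<close> on
  \<open>(y, w)\<close> alone contributes \<open>l y * h\<close> at \<open>w\<close>, which may be negative.\<close>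

lemma biased_superharmonic_if_brw_return_prob_less_1:
  assumes ab: "{a, b} \<in> E"
    and r1: "return_prob (directed_edges E) (brw E p) (a, b) < 1"
    and r2: "return_prob (directed_edges E) (brw E p) (b, a) < 1"
  shows "\<exists>A. biased.strictly_superharmonic_at a A"
proof -
  let ?P = "step_pmf (directed_edges E) (brw E p)"
  \<comment> \<open>Dividing the hitting probability by the escape probability normalises its defect
    at \<open>s\<close> to 1.\<close>
  have charge: "\<exists>(f :: 'a \<times> 'a \<Rightarrow> real) B. (\<forall>e. \<bar>f e\<bar> \<le> B) \<and> (\<forall>e. (\<integral>e'. f e' \<partial>?P e) = f e - of_bool (e = s))"
    if r: "return_prob (directed_edges E) (brw E p) s < 1" for s
  proof -
    let ?r = "1 - return_prob (directed_edges E) (brw E p) s"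
    obtain f where f: "\<And>x. 0 \<le> f x" "\<And>x. f x \<le> 1" "f s = 1"
      "\<And>x. x \<noteq> s \<Longrightarrow> (\<integral>y. f y \<partial>?P x) = f x"
      "(\<integral>y. f y \<partial>?P s) = return_prob (directed_edges E) (brw E p) s"
      by (rule hitting_prob_exists[where s = s and S = "directed_edges E" and K = "brw E p"]) (rule that)
    have "\<bar>f e / ?r\<bar> \<le> 1 / ?r" for e
      using f(1,2)[of e] r by (simp add: divide_right_mono)
    moreover have "(\<integral>e'. f e' / ?r \<partial>?P e) = f e / ?r - of_bool (e = s)" for e
      using f(3-5) r by (cases "e = s") (auto simp: field_simps)
    ultimately show ?thesis by (intro exI[of _ "\<lambda>e. f e / ?r"] exI[of _ "1 / ?r"]) auto
  qed
  obtain f1 :: "'a \<times> 'a \<Rightarrow> real" and B1 where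
    f1: "\<And>e. \<bar>f1 e\<bar> \<le> B1" "\<And>e. (\<integral>e'. f1 e' \<partial>?P e) = f1 e - of_bool (e = (a, b))"
    using charge[OF r1] by metis
  obtain f2 :: "'a \<times> 'a \<Rightarrow> real" and B2 where
    f2: "\<And>e. \<bar>f2 e\<bar> \<le> B2" "\<And>e. (\<integral>e'. f2 e' \<partial>?P e) = f2 e - of_bool (e = (b, a))"
    using charge[OF r2] by metis
  define f where "f e = f1 e + f2 e" for e
  define h :: "'a \<times> 'a \<Rightarrow> real" where "h e = of_bool (e = (a, b)) + of_bool (e = (b, a))" for e
  have h_sym: "h (y, x) = h (x, y)" for x y
    by (simp add: h_def conj_commute add.commute)
  have f_le: "\<bar>f e\<bar> \<le> B1 + B2" for e
    using f1(1)[of e] f2(1)[of e] by (simp add: f_def)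
  have Pf: "(\<integral>e'. f e' \<partial>?P e) = f e - h e" for e
  proof -
    have "integrable (?P e) f1" "integrable (?P e) f2"
      by (rule integrable_measure_pmf_bounded[OF f1(1)] integrable_measure_pmf_bounded[OF f2(1)])+
    then show ?thesis by (simp add: f_def h_def f1(2) f2(2))
  qed
  define A where "A y = (\<Sum>w\<in>neighbours E y. f (y, w)) / real (deg E y)" for y
  have f_eq: "f (x, y) = (1 - l y) * A y + l y * f (y, x) + h (x, y)" if "{x, y} \<in> E" for x y
    using Pf[of "(x, y)"] brw_step_expectation[OF that, of f] by (simp add: A_def)
  have flow: "biased.flow A y
      = - (1 - l y) * (\<Sum>w\<in>neighbours E y. (1 + l w) * h (y, w) / (1 - l y * l w))" for y
  proof -
    have "biased.flow A y = (\<Sum>w\<in>neighbours E y.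
        (1 - l y) * (f (y, w) - A y - (1 + l w) * h (y, w) / (1 - l y * l w)))"
      unfolding biased.flow_def
    proof (intro sum.cong refl)
      fix w assume w: "w \<in> neighbours E y"
      then have "{y, w} \<in> E" "{w, y} \<in> E" by (auto simp: neighbours_def insert_commute)
      note eqs = f_eq[OF this(1)] f_eq[OF this(2)]
      \<comment> \<open>Substituting the equation of the reversed edge brings in
        \<open>l w * h (w, y)\<close>; by symmetry of \<open>h\<close> the total charge has the
        positive coefficient \<open>1 + l w\<close>.\<close>
      have "f (y, w) = (1 - l w) * A w + l w * ((1 - l y) * A y + l y * f (y, w) + h (y, w)) + h (y, w)"
        using eqs h_sym[of w y] by simp
      then have "f (y, w) * (1 - l y * l w)
          = (1 - l w) * A w + l w * (1 - l y) * A y + (1 + l w) * h (y, w)"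
        by (simp add: algebra_simps)
      then have *: "f (y, w) = ((1 - l w) * A w + l w * (1 - l y) * A y + (1 + l w) * h (y, w)) / (1 - l y * l w)"
        using l_mult_bounds(3)[of y w] by (simp add: eq_divide_eq)
      show "brw_conductance E p y w * (A w - A y)
          = (1 - l y) * (f (y, w) - A y - (1 + l w) * h (y, w) / (1 - l y * l w))"
        unfolding * using w l_mult_bounds(3)[of y w]
        by (simp add: brw_conductance_def neighbours_def divide_simps) (simp add: algebra_simps)
    qed
    also have "\<dots> = (1 - l y) * ((\<Sum>w\<in>neighbours E y. f (y, w)) - real (deg E y) * A y
        - (\<Sum>w\<in>neighbours E y. (1 + l w) * h (y, w) / (1 - l y * l w)))"
      by (simp add: sum_distrib_left[symmetric] sum_subtractf deg_def)
    also have "(\<Sum>w\<in>neighbours E y. f (y, w)) = real (deg E y) * A y"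
      using finite_neighbours[of y] by (auto simp: A_def deg_def)
    finally show ?thesis by (simp add: left_diff_distrib)
  qed
  have term_nonneg: "0 \<le> (1 + l w) * h (y, w) / (1 - l y * l w)" for y w
    using l_bounds(1)[of w] l_mult_bounds(3)[of y w]
    by (intro divide_nonneg_pos mult_nonneg_nonneg) (simp_all add: h_def)
  have "biased.flow A y \<le> 0" for y
    unfolding flow using l_bounds(2)[of y]
    by (intro mult_nonpos_nonneg sum_nonneg term_nonneg) simp
  moreover have "biased.flow A a < 0"
    unfolding flow
  proof (rule mult_neg_pos)
    show "- (1 - l a) < 0" using l_bounds(2)[of a] by simp
    show "0 < (\<Sum>w\<in>neighbours E a. (1 + l w) * h (a, w) / (1 - l a * l w))"
    proof (rule sum_pos2[OF finite_neighbours])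
      show "b \<in> neighbours E a" using ab by (simp add: neighbours_def)
      show "0 < (1 + l b) * h (a, b) / (1 - l a * l b)"
        using l_bounds(1)[of b] l_mult_bounds(3)[of a b]
        by (intro divide_pos_pos mult_pos_pos) (auto simp: h_def)
    qed (rule term_nonneg)
  qed
  moreover have "\<bar>A y\<bar> \<le> B1 + B2" for y
  proof (cases "deg E y = 0")
    case True
    \<comment> \<open>Here \<open>A y\<close> is 0 by division by zero; any instance of
      \<open>f_le\<close> shows that the bound is nonnegative.\<close>
    then show ?thesis using f_le[of undefined] by (simp add: A_def)
  next
    case False
    have "\<bar>\<Sum>w\<in>neighbours E y. f (y, w)\<bar> \<le> (\<Sum>w\<in>neighbours E y. B1 + B2)"
      by (rule order_trans[OF sum_abs sum_mono[OF f_le]])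
    then show ?thesis
      using False by (simp add: A_def deg_def[symmetric] pos_divide_le_eq mult.commute)
  qed
  ultimately show ?thesis by (auto simp: biased.strictly_superharmonic_at_def)
qed

text \<open>Connectedness gives every vertex an incident edge once there is an edge at all; an
  isolated vertex would be recurrent for simple random walk.\<close>

lemma brw_transient_iff_srw_transient:
  assumes conn: "connected_graph V E"
  shows "brw_transient E p \<longleftrightarrow> srw_transient V E"
proof
  assume L: "brw_transient E p"
  then have "directed_edges E \<noteq> {}"
    and ret': "\<And>e. e \<in> directed_edges E \<Longrightarrow> return_prob (directed_edges E) (brw E p) e < 1"
    by (simp_all add: brw_transient_def transient_chain_def)
  then obtain a0 b0 where e0: "{a0, b0} \<in> E"
    by (auto simp: directed_edges_def)
  have ret: "return_prob (directed_edges E) (brw E p) (a, b) < 1" if "{a, b} \<in> E" for a b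
    by (rule ret') (simp add: directed_edges_def that)
  have "return_prob V (srw E) a < 1" if "a \<in> V" for a
  proof -
    have "(a, a0) \<in> (directed_edges E)\<^sup>*"
      using conn that edge_in_V[OF e0] by (simp add: connected_graph_def)
    \<comment> \<open>If the path to \<open>a0\<close> is trivial, \<open>b0\<close> serves;
      otherwise its first edge does.\<close>
    then obtain b where "{a, b} \<in> E"
      using e0 by (cases rule: converse_rtranclE) (auto simp: directed_edges_def)
    then have "\<exists>A. biased.strictly_superharmonic_at a A"
      by (intro biased_superharmonic_if_brw_return_prob_less_1 ret) (simp_all add: insert_commute)
    then show ?thesis
      by (simp add: srw_return_prob_iff superharmonic_unit_iff_biased)
  qed
  then show "srw_transient V E"
    using edge_in_V[OF e0] by (auto simp: srw_transient_def transient_chain_def)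
next
  assume R: "srw_transient V E"
  then have super: "\<exists>A. biased.strictly_superharmonic_at b A" if "b \<in> V" for b
    using that by (simp add: srw_transient_def transient_chain_def srw_return_prob_iff
        superharmonic_unit_iff_biased)
  obtain v where "v \<in> V" using R by (auto simp: srw_transient_def transient_chain_def)
  then obtain A where "biased.flow A v < 0"
    using super[of v] by (auto simp: biased.strictly_superharmonic_at_def)
  \<comment> \<open>A negative flow needs a summand, so the state space of the \<open>p\<close>-BRW
    is nonempty, as transience demands.\<close>
  then have "neighbours E v \<noteq> {}" by (auto simp: biased.flow_def)
  then have "directed_edges E \<noteq> {}" by (auto simp: neighbours_def directed_edges_def)
  moreover have "return_prob (directed_edges E) (brw E p) e < 1" if "e \<in> directed_edges E" for e
  proof -
    obtain a b where e: "e = (a, b)" and ab: "{a, b} \<in> E"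
      using \<open>e \<in> directed_edges E\<close> by (auto simp: directed_edges_def)
    then show ?thesis
      using super[of b] edge_in_V[OF ab] brw_return_prob_less_1I[OF _ ab] by blast
  qed
  ultimately show "brw_transient E p"
    by (simp add: brw_transient_def transient_chain_def)
qed

end

theorem theorem3:
  fixes V :: "'a set" and E :: "'a set set"
  assumes "simple_graph V E"
    and "connected_graph V E"
    and "bounded_degree V E"
  shows "\<forall>p::real. 0 < p \<and> p < 1 \<longrightarrow> (brw_transient E p \<longleftrightarrow> srw_transient V E)"
proof (intro allI impI)
  fix p :: real
  assume "0 < p \<and> p < 1"
  then interpret brw_graph V E p
    using assms by unfold_locales auto
  show "brw_transient E p \<longleftrightarrow> srw_transient V E"
    by (rule brw_transient_iff_srw_transient) (rule assms)
qed

end
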